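(* Let $\mathcal L$ be a quasi-definite linear functional on $\mathrm{Sym}(W^{\mathrm{gr}})$ and let $\{\mathbf p_n\}_{n\ge0}$ be a system of block orthogonal polynomials for $\mathcal L$, with $H_n=(\mathbf p_n,\mathbf p_n^{\intercal})$. For $n\in\mathbb N_0$, $m\in[n]$, $i\in[N_m]$ and $-m\le k\le m$, there exist unique matrices $M^k_{n,m,i}\in\mathrm{Mat}(r_{n-m},r_{n-m+k})$ such that $$w_{m,i}\,\mathbf p_{n-m}=\sum_{k=-m}^{m}M^k_{n,m,i}\,\mathbf p_{n-m+k}.$$ These matrices satisfy $$M^k_{n,m,i}\,H_{n-m+k}=H_{n-m}\,(M^{-k}_{n+k,m,i})^{\intercal}.$$
   Context: $W=\bigoplus_{m\ge1}W^m$ is a graded real vector space with every $W^m$ finite-dimensional, $N_m=\dim W^m$; $W^{\mathrm{gr}}=\bigoplus_m (W^m)^*$ is the graded dual, and $w_{m,1},\dots,w_{m,N_m}$ is a fixed basis of $(W^m)^*$. $\mathrm{Sym}(W^{\mathrm{gr}})$ is the symmetric algebra, i.e. the commutative real polynomial algebra in the indeterminates $w_{m,i}$. The total degree of a monomial $\prod w_{m,i}^{\alpha_{m,i}}$ is $\sum m\,\alpha_{m,i}$. $r_n$ is the number of monomials of total degree $n$ and $\mathbf w_n$ the column vector of these monomials. $[n]=\{1,\dots,n\}$. $\mathrm{Mat}(a,b)$ denotes real $a\times b$ matrices. Objects with negative degree index are absent ($r_j=0$ and $\mathbf p_j=0$ for $j<0$). A linear functional $\mathcal L:\mathrm{Sym}(W^{\mathrm{gr}})\to\mathbb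 R$ is quasi-definite if there is a basis of $\mathrm{Sym}(W^{\mathrm{gr}})$ such that for basis elements $P,Q$: $\mathcal L(PQ)=0$ if $P\ne Q$ and $\mathcal L(P^2)\neq0$. Write $(P,Q)=\mathcal L(PQ)$; for column vectors $\mathbf p,\mathbf q$ of polynomials, $(\mathbf p,\mathbf q^{\intercal})$ is the matrix of entrywise values. A sequence $\{\mathbf p_n\}_{n\ge0}$, with $\mathbf p_n\in\mathrm{Sym}(W^{\mathrm{gr}})^{r_n}$ a column vector whose entries have total degree at most $n$, is block orthogonal if $(\mathbf w_m,\mathbf p_n^{\intercal})=0$ for all $m<n$ and $(\mathbf w_n,\mathbf p_n^{\intercal})$ is invertible; then $H_n$ is symmetric and invertible. *)

theory Defs
  imports Complex_Main "HOL-Library.Poly_Mapping" "Jordan_Normal_Form.Matrix"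
begin

(* Polynomials are elements of the monoid algebra of Poly_Mapping.  The real vector space
   structure is what gives access to the notions span, independent of the library. *)

instantiation poly_mapping :: (type, real_vector) real_vector
begin

lift_definition scaleR_poly_mapping :: "real \<Rightarrow> ('a \<Rightarrow>\<^sub>0 'b) \<Rightarrow> ('a \<Rightarrow>\<^sub>0 'b)"
  is "\<lambda>c f x. c *\<^sub>R f x"
  by (rule finite_subset[rotated]) auto

instance
  by standard (transfer; simp add: fun_eq_iff scaleR_add_right scaleR_add_left)+

end

(* The indeterminate w_{m,i} is represented by the pair (m, i).  A graded vector space W enters
   only through N, where N m is the dimension of W^m; the dual basis of (W^m)^* is
   w_{m,1}, ..., w_{m,N m}, and N m = 0 is allowed. *)

type_synonym monomial = "(nat \<times> nat) \<Rightarrow>\<^sub>0 nat"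
type_synonym polynomial = "monomial \<Rightarrow>\<^sub>0 real"

definition indets :: "(nat \<Rightarrow> nat) \<Rightarrow> (nat \<times> nat) set" where
  "indets N = {(m, i). 1 \<le> m \<and> i \<in> {1..N m}}"

definition monomials :: "(nat \<Rightarrow> nat) \<Rightarrow> monomial set" where
  "monomials N = {\<alpha>. Poly_Mapping.keys \<alpha> \<subseteq> indets N}"

definition Sym :: "(nat \<Rightarrow> nat) \<Rightarrow> polynomial set" where
  "Sym N = {P. Poly_Mapping.keys P \<subseteq> monomials N}"

definition indet :: "nat \<Rightarrow> nat \<Rightarrow> polynomial" where
  "indet m i = Poly_Mapping.single (Poly_Mapping.single (m, i) 1) 1"

definition tdeg :: "monomial \<Rightarrow> nat" where
  "tdeg \<alpha> = (\<Sum>(m, i)\<in>Poly_Mapping.keys \<alpha>. m * Poly_Mapping.lookup \<alpha> (m, i))"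

definition tdeg_le :: "polynomial \<Rightarrow> nat \<Rightarrow> bool" where
  "tdeg_le P n \<longleftrightarrow> (\<forall>\<alpha>\<in>Poly_Mapping.keys P. tdeg \<alpha> \<le> n)"

(* The number r_j of monomials of total degree j; the index is an integer, so that r_j = 0
   for j < 0. *)
definition num_monomials :: "(nat \<Rightarrow> nat) \<Rightarrow> int \<Rightarrow> nat" where
  "num_monomials N j = card {\<alpha> \<in> monomials N. int (tdeg \<alpha>) = j}"

(* ws n is a column vector listing each monomial of total degree n exactly once; the ordering
   is arbitrary. *)
definition monomial_vectors :: "(nat \<Rightarrow> nat) \<Rightarrow> (nat \<Rightarrow> polynomial vec) \<Rightarrow> bool" where
  "monomial_vectors N ws \<longleftrightarrow>
     (\<forall>n. distinct (list_of_vec (ws n)) \<and>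
          set\<^sub>v (ws n) = (\<lambda>\<alpha>. Poly_Mapping.single \<alpha> 1) ` {\<alpha> \<in> monomials N. tdeg \<alpha> = n})"

(* A functional on Sym N is a function on the ambient type; only its values on Sym N matter. *)
definition linear_functional :: "(nat \<Rightarrow> nat) \<Rightarrow> (polynomial \<Rightarrow> real) \<Rightarrow> bool" where
  "linear_functional N L \<longleftrightarrow>
     (\<forall>P\<in>Sym N. \<forall>Q\<in>Sym N. L (P + Q) = L P + L Q) \<and>
     (\<forall>c. \<forall>P\<in>Sym N. L (c *\<^sub>R P) = c * L P)"

definition quasi_definite :: "(nat \<Rightarrow> nat) \<Rightarrow> (polynomial \<Rightarrow> real) \<Rightarrow> bool" where
  "quasi_definite N L \<longleftrightarrow>
     (\<exists>B. independent B \<and> span B = Sym N \<and>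
          (\<forall>P\<in>B. \<forall>Q\<in>B. P \<noteq> Q \<longrightarrow> L (P * Q) = 0) \<and>
          (\<forall>P\<in>B. L (P * P) \<noteq> 0))"

(* The matrix (p, q^T) with entries L (p_a q_b). *)
definition pairing :: "(polynomial \<Rightarrow> real) \<Rightarrow> polynomial vec \<Rightarrow> polynomial vec \<Rightarrow> real mat" where
  "pairing L p q = mat (dim_vec p) (dim_vec q) (\<lambda>(a, b). L (p $ a * q $ b))"

definition block_orthogonal ::
  "(nat \<Rightarrow> nat) \<Rightarrow> (polynomial \<Rightarrow> real) \<Rightarrow> (nat \<Rightarrow> polynomial vec) \<Rightarrow> (nat \<Rightarrow> polynomial vec) \<Rightarrow> bool"
where
  "block_orthogonal N L ws p \<longleftrightarrow>
     (\<forall>n. p n \<in> carrier_vec (num_monomials N (int n)) \<and>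
          (\<forall>P\<in>set\<^sub>v (p n). P \<in> Sym N \<and> tdeg_le P n)) \<and>
     (\<forall>n. \<forall>m<n. pairing L (ws m) (p n) =
          0\<^sub>m (num_monomials N (int m)) (num_monomials N (int n))) \<and>
     (\<forall>n. invertible_mat (pairing L (ws n) (p n)))"

(* p_j for an integer j, with the empty vector as p_j for j < 0. *)
definition ext_neg :: "(nat \<Rightarrow> polynomial vec) \<Rightarrow> int \<Rightarrow> polynomial vec" where
  "ext_neg p j = (if j < 0 then 0\<^sub>v 0 else p (nat j))"

(* H_j = (p_j, p_j^T); for j < 0 this is the 0 x 0 matrix. *)
definition gram :: "(polynomial \<Rightarrow> real) \<Rightarrow> (nat \<Rightarrow> polynomial vec) \<Rightarrow> int \<Rightarrow> real mat" where
  "gram L p j = pairing L (ext_neg p j) (ext_neg p j)"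

(* A real matrix acts on a column vector of polynomials through the constant polynomials
   Poly_Mapping.single 0 c. *)
definition recurrence_matrices ::
  "(nat \<Rightarrow> nat) \<Rightarrow> (nat \<Rightarrow> polynomial vec) \<Rightarrow> nat \<Rightarrow> nat \<Rightarrow> nat \<Rightarrow> (int \<Rightarrow> real mat) \<Rightarrow> bool"
where
  "recurrence_matrices N p n m i A \<longleftrightarrow>
     (\<forall>k\<in>{- int m..int m}. A k \<in> carrier_mat (num_monomials N (int n - int m))
                                           (num_monomials N (int n - int m + k))) \<and>
     indet m i \<cdot>\<^sub>v ext_neg p (int n - int m) =
       finsum_vec TYPE(polynomial) (num_monomials N (int n - int m))
         (\<lambda>k. map_mat (Poly_Mapping.single 0) (A k) *\<^sub>v ext_neg p (int n - int m + k))
         {- int m..int m}"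

end

theory Submission
  imports Defs
begin

text \<open>
  Block orthogonality says that the matrix with blocks \<open>(w\<^sub>l, p\<^sub>j\<^sup>T)\<close> is block triangular with
  invertible diagonal blocks.  Hence, if \<open>Q = \<Sum>\<^sub>j c\<^sub>j p\<^sub>j\<close> pairs to zero with every monomial of
  degree below \<open>s\<close>, then \<open>c\<^sub>j = 0\<close> for all \<open>j < s\<close> (\<open>low_coefficients_zero\<close>).  In particular the
  entries of the \<open>p\<^sub>j\<close> are linearly independent (\<open>P_independent\<close>), which gives uniqueness.  There
  are as many entries with \<open>j \<le> d\<close> as there are monomials of degree at most \<open>d\<close>, so they span
  all polynomials of degree at most \<open>d\<close> (\<open>P_spans\<close>).

  For existence, an entry of \<open>w\<^sub>m\<^sub>,\<^sub>i p\<^sub>n\<^sub>-\<^sub>m\<close> has degree at most \<open>n\<close>, so it expands in the \<open>p\<^sub>j\<close> with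
  \<open>j \<le> n\<close>.  It is orthogonal to every monomial \<open>w\<close> of degree below \<open>n - 2m\<close>, because
  \<open>w w\<^sub>m\<^sub>,\<^sub>i\<close> is a monomial of degree below \<open>n - m\<close>; thus only \<open>n - 2m \<le> j \<le> n\<close> occur.

  Since \<open>(p\<^sub>i, p\<^sub>j\<^sup>T) = 0\<close> for \<open>i \<noteq> j\<close>, pairing the recurrence with \<open>p\<^sub>n\<^sub>-\<^sub>m\<^sub>+\<^sub>k\<close> shows that the product of
  the \<open>k\<close>-th matrix with \<open>H\<^sub>n\<^sub>-\<^sub>m\<^sub>+\<^sub>k\<close> is \<open>(w\<^sub>m\<^sub>,\<^sub>i p\<^sub>n\<^sub>-\<^sub>m, p\<^sub>n\<^sub>-\<^sub>m\<^sub>+\<^sub>k\<^sup>T)\<close>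
  (\<open>recurrence_matrix_times_gram\<close>).  Both sides of the symmetry relation are therefore matrices
  with entries \<open>L (w p q)\<close>, where \<open>w = w\<^sub>m\<^sub>,\<^sub>i\<close>, \<open>p\<close> runs through \<open>p\<^sub>n\<^sub>-\<^sub>m\<close> and \<open>q\<close> through
  \<open>p\<^sub>n\<^sub>-\<^sub>m\<^sub>+\<^sub>k\<close>, and they agree by commutativity.
\<close>

section \<open>Spanning by counting\<close>

text \<open>A linearly independent family in \<open>span T\<close> with at least \<open>card T\<close> members spans \<open>span T\<close>.
  Independence is stated for the indexed family, so distinctness of its members is a consequence.\<close>

lemma span_family_eq_of_card_le:
  fixes f :: "'i \<Rightarrow> 'v::real_vector"
  assumes I: "finite I" and T: "finite T" and card: "card T \<le> card I"
    and fT: "f ` I \<subseteq> span T"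
    and indep: "\<And>c. (\<Sum>i\<in>I. c i *\<^sub>R f i) = 0 \<Longrightarrow> \<forall>i\<in>I. c i = 0"
    and v: "v \<in> span T"
  shows "\<exists>c. v = (\<Sum>i\<in>I. c i *\<^sub>R f i)"
proof -
  have inj: "inj_on f I"
  proof (rule inj_onI, rule ccontr)
    fix x y assume xy: "x \<in> I" "y \<in> I" "f x = f y" "x \<noteq> y"
    let ?c = "\<lambda>i. if i = x then 1 else if i = y then - 1 else (0::real)"
    have "(\<Sum>i\<in>I. ?c i *\<^sub>R f i) = (\<Sum>i\<in>{x, y}. ?c i *\<^sub>R f i)"
      using xy I by (intro sum.mono_neutral_right) auto
    also have "\<dots> = 0" using xy by simp
    finally show False using bspec[OF indep xy(1)] by fastforce
  qed
  have ind: "independent (f ` I)"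
  proof
    assume "dependent (f ` I)"
    then obtain u w where w: "w \<in> f ` I" "u w \<noteq> 0" and u: "(\<Sum>w\<in>f ` I. u w *\<^sub>R w) = 0"
      using I by (auto simp: real_vector.dependent_finite)
    from u have "(\<Sum>i\<in>I. u (f i) *\<^sub>R f i) = 0" using inj by (simp add: sum.reindex)
    from indep[OF this] w show False by auto
  qed
  have "v \<in> span (f ` I)"
  proof (rule ccontr)
    assume nv: "v \<notin> span (f ` I)"
    then have "v \<notin> f ` I" using real_vector.span_base by blast
    moreover have "independent (insert v (f ` I))"
      using ind nv by (simp add: real_vector.independent_insert)
    then have "card (insert v (f ` I)) \<le> card T"
      using real_vector.independent_span_bound[OF T] fT v by blast
    ultimately have "Suc (card I) \<le> card T" using I inj by (simp add: card_image)
    then show False using card by simp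
  qed
  then obtain u where "v = (\<Sum>w\<in>f ` I. u w *\<^sub>R w)"
    using I by (auto simp: real_vector.span_finite)
  then have "v = (\<Sum>i\<in>I. u (f i) *\<^sub>R f i)" using inj by (simp add: sum.reindex)
  then show ?thesis by (rule exI[of _ "\<lambda>i. u (f i)"])
qed

section \<open>The graded polynomial algebra\<close>

text \<open>The monomial with exponent \<open>\<alpha>\<close>, regarded as a polynomial.\<close>

abbreviation mon :: "monomial \<Rightarrow> polynomial" where
  "mon \<alpha> \<equiv> Poly_Mapping.single \<alpha> 1"

lemma lookup_scaleR [simp]: "Poly_Mapping.lookup (c *\<^sub>R P) \<alpha> = c *\<^sub>R Poly_Mapping.lookup P \<alpha>"
  by transfer simp

lemma single_0_times: "Poly_Mapping.single 0 c * P = c *\<^sub>R (P :: polynomial)"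
proof -
  have "Poly_Mapping.lookup (Poly_Mapping.single 0 c * P) \<alpha> = c * Poly_Mapping.lookup P \<alpha>" for \<alpha>
    by (simp flip: mult_map_scale_conv_mult add: map.rep_eq when_def)
  then show ?thesis by (intro poly_mapping_eqI) simp
qed

lemma scaleR_times_left: "(c *\<^sub>R P) * Q = c *\<^sub>R (P * (Q :: polynomial))"
  by (simp flip: single_0_times add: mult.assoc)

lemma scaleR_times_right: "P * (c *\<^sub>R Q) = c *\<^sub>R (P * (Q :: polynomial))"
  using scaleR_times_left[of c Q P] by (simp add: mult.commute)

lemma polynomial_eq_sum_mon:
  "P = (\<Sum>\<alpha>\<in>Poly_Mapping.keys P. Poly_Mapping.lookup P \<alpha> *\<^sub>R mon \<alpha>)"
proof (rule poly_mapping_eqI)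
  fix \<beta>
  show "Poly_Mapping.lookup P \<beta> =
    Poly_Mapping.lookup (\<Sum>\<alpha>\<in>Poly_Mapping.keys P. Poly_Mapping.lookup P \<alpha> *\<^sub>R mon \<alpha>) \<beta>"
    by (simp add: lookup_sum lookup_single when_def if_distrib in_keys_iff cong: if_cong)
qed

lemma tdeg_eq_sum_superset:
  assumes "finite S" "Poly_Mapping.keys \<alpha> \<subseteq> S"
  shows "tdeg \<alpha> = (\<Sum>x\<in>S. fst x * Poly_Mapping.lookup \<alpha> x)"
  unfolding tdeg_def case_prod_beta prod.collapse
  using assms by (intro sum.mono_neutral_left) (auto simp: in_keys_iff)

lemma tdeg_add: "tdeg (\<alpha> + \<beta>) = tdeg \<alpha> + tdeg \<beta>"
proof -
  let ?S = "Poly_Mapping.keys \<alpha> \<union> Poly_Mapping.keys \<beta>"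
  have "finite ?S" "Poly_Mapping.keys (\<alpha> + \<beta>) \<subseteq> ?S" by (simp_all add: keys_add)
  then show ?thesis
    by (simp add: tdeg_eq_sum_superset[of ?S] lookup_add distrib_left sum.distrib)
qed

lemma tdeg_single: "tdeg (Poly_Mapping.single (m, i) 1) = m"
  by (simp add: tdeg_def)

lemma monomials_add: "\<alpha> \<in> monomials N \<Longrightarrow> \<beta> \<in> monomials N \<Longrightarrow> \<alpha> + \<beta> \<in> monomials N"
  using keys_add[of \<alpha> \<beta>] by (auto simp: monomials_def)

lemma mon_in_Sym: "\<alpha> \<in> monomials N \<Longrightarrow> mon \<alpha> \<in> Sym N"
  by (simp add: Sym_def)

lemma subspace_Sym: "real_vector.subspace (Sym N)"
proof (rule real_vector.subspaceI)
  show "0 \<in> Sym N" by (simp add: Sym_def)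
  show "P + Q \<in> Sym N" if "P \<in> Sym N" "Q \<in> Sym N" for P Q
    using that keys_add[of P Q] by (auto simp: Sym_def)
  show "c *\<^sub>R P \<in> Sym N" if "P \<in> Sym N" for c P
    using that by (auto simp: Sym_def in_keys_iff subset_iff)
qed

lemma keys_timesE:
  fixes P Q :: polynomial
  assumes "\<gamma> \<in> Poly_Mapping.keys (P * Q)"
  obtains \<alpha> \<beta> where "\<gamma> = \<alpha> + \<beta>" "\<alpha> \<in> Poly_Mapping.keys P" "\<beta> \<in> Poly_Mapping.keys Q"
  using subsetD[OF keys_mult assms] by blast

lemma times_in_Sym:
  assumes "P \<in> Sym N" "Q \<in> Sym N"
  shows "P * Q \<in> Sym N"
proof -
  have "\<gamma> \<in> monomials N" if "\<gamma> \<in> Poly_Mapping.keys (P * Q)" for \<gamma>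
    using that assms by (elim keys_timesE) (auto simp: Sym_def intro!: monomials_add)
  then show ?thesis by (auto simp: Sym_def)
qed

lemma tdeg_le_times:
  assumes "tdeg_le P a" "tdeg_le Q b"
  shows "tdeg_le (P * Q) (a + b)"
proof -
  have "tdeg \<gamma> \<le> a + b" if "\<gamma> \<in> Poly_Mapping.keys (P * Q)" for \<gamma>
    using that assms by (elim keys_timesE) (simp add: tdeg_le_def tdeg_add add_mono)
  then show ?thesis by (simp add: tdeg_le_def)
qed

lemma indet_eq_mon: "indet m i = mon (Poly_Mapping.single (m, i) 1)"
  by (simp add: indet_def)

lemma indet_monomial:
  assumes "m \<ge> 1" "i \<in> {1..N m}"
  shows "Poly_Mapping.single (m, i) 1 \<in> monomials N"
  using assms by (simp add: monomials_def indets_def)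

section \<open>Block orthogonal systems\<close>

text \<open>A block orthogonal system \<open>p\<close> for a linear functional \<open>L\<close>, with the monomials of degree \<open>n\<close>
  listed by the vector \<open>ws n\<close>.\<close>

locale block_orthogonal_system =
  fixes N :: "nat \<Rightarrow> nat" and L :: "polynomial \<Rightarrow> real" and ws p :: "nat \<Rightarrow> polynomial vec"
  assumes ws: "monomial_vectors N ws"
    and L: "linear_functional N L"
    and bo: "block_orthogonal N L ws p"
begin

text \<open>Blocks are indexed by integers from here on: for \<open>j < 0\<close> the number \<open>r j\<close> is \<open>0\<close> and \<open>P j\<close> is the empty
  vector, so that sums over the entries of \<open>P j\<close> need no case distinction.\<close>

abbreviation "r \<equiv> num_monomials N"
abbreviation "P \<equiv> ext_neg p"

lemma L_scaleR: "Q \<in> Sym N \<Longrightarrow> L (c *\<^sub>R Q) = c * L Q"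
  using L by (simp add: linear_functional_def)

lemma L_sum:
  assumes "\<And>x. x \<in> A \<Longrightarrow> f x \<in> Sym N"
  shows "L (\<Sum>x\<in>A. f x) = (\<Sum>x\<in>A. L (f x))"
  using assms
proof (induction A rule: infinite_finite_induct)
  case (insert x A)
  then have "(\<Sum>x\<in>A. f x) \<in> Sym N"
    by (intro real_vector.subspace_sum[OF subspace_Sym]) auto
  then show ?case using insert L by (simp add: linear_functional_def)
qed (use L_scaleR[of 0 0] in \<open>simp_all add: Sym_def\<close>)

lemma set_ws: "set\<^sub>v (ws n) = mon ` {\<alpha> \<in> monomials N. tdeg \<alpha> = n}"
  using ws by (simp add: monomial_vectors_def)

lemma inj_mon: "inj_on mon A"
proof (rule inj_onI)
  fix \<alpha> \<beta> :: monomial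
  assume "mon \<alpha> = mon \<beta>"
  then have "Poly_Mapping.keys (mon \<alpha>) = Poly_Mapping.keys (mon \<beta>)" by simp
  then show "\<alpha> = \<beta>" by simp
qed

text \<open>Finiteness holds because the monomials of one degree are listed by a vector.\<close>

lemma finite_monomials: "finite {\<alpha> \<in> monomials N. tdeg \<alpha> = n}"
proof (rule finite_imageD[OF _ inj_mon])
  show "finite (mon ` {\<alpha> \<in> monomials N. tdeg \<alpha> = n})"
    unfolding set_ws[symmetric] by (simp add: vec_set_def)
qed

lemma dim_ws: "dim_vec (ws n) = r (int n)"
proof -
  have "dim_vec (ws n) = card (set (list_of_vec (ws n)))"
    using ws by (simp add: monomial_vectors_def distinct_card)
  also have "\<dots> = card {\<alpha> \<in> monomials N. tdeg \<alpha> = n}"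
    by (simp add: set_list_of_vec set_ws card_image inj_mon)
  finally show ?thesis by (simp add: num_monomials_def)
qed

lemma r_negative: "j < 0 \<Longrightarrow> r j = 0"
  by (auto simp: num_monomials_def)

lemma dim_P [simp]: "dim_vec (P j) = r j"
proof (cases "j < 0")
  case False
  have "p (nat j) \<in> carrier_vec (r (int (nat j)))" using bo unfolding block_orthogonal_def by blast
  then show ?thesis using False by (simp add: ext_neg_def)
qed (simp add: ext_neg_def r_negative)

lemma P_entry:
  assumes "b < r j"
  shows "P j $ b \<in> Sym N" "tdeg_le (P j $ b) (nat j)" "0 \<le> j"
proof -
  show "0 \<le> j" using assms r_negative[of j] by (cases "j < 0") auto
  then have "P j $ b \<in> set\<^sub>v (p (nat j))"
    using assms dim_P[of j] by (auto simp: ext_neg_def vec_set_def)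
  then show "P j $ b \<in> Sym N" "tdeg_le (P j $ b) (nat j)"
    using bo by (auto simp: block_orthogonal_def)
qed

lemma mon_orthogonal:
  assumes "\<alpha> \<in> monomials N" "int (tdeg \<alpha>) < j" "b < r j"
  shows "L (mon \<alpha> * P j $ b) = 0"
proof -
  have "mon \<alpha> \<in> set\<^sub>v (ws (tdeg \<alpha>))" using assms by (auto simp: set_ws)
  then obtain a where a: "ws (tdeg \<alpha>) $ a = mon \<alpha>" "a < dim_vec (ws (tdeg \<alpha>))" by (rule vec_setE)
  have "pairing L (ws (tdeg \<alpha>)) (p (nat j)) = 0\<^sub>m (r (tdeg \<alpha>)) (r (nat j))"
    using bo assms(2) by (simp add: block_orthogonal_def)
  then have "pairing L (ws (tdeg \<alpha>)) (p (nat j)) $$ (a, b) = 0"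
    using a(2) assms by (simp add: dim_ws)
  then show ?thesis using a assms dim_P[of j] by (simp add: pairing_def ext_neg_def)
qed

lemma low_degree_orthogonal:
  assumes "Q \<in> Sym N" "tdeg_le Q d" "int d < j" "b < r j"
  shows "L (Q * P j $ b) = 0"
proof -
  have S: "mon \<alpha> * P j $ b \<in> Sym N" if "\<alpha> \<in> Poly_Mapping.keys Q" for \<alpha>
    using that assms(1) P_entry(1)[OF assms(4)]
    by (intro times_in_Sym mon_in_Sym) (auto simp: Sym_def)
  have "L (mon \<alpha> * P j $ b) = 0" if "\<alpha> \<in> Poly_Mapping.keys Q" for \<alpha>
    using that assms by (intro mon_orthogonal) (auto simp: Sym_def tdeg_le_def intro: le_less_trans)
  moreover have "L (Q * P j $ b) =
      (\<Sum>\<alpha>\<in>Poly_Mapping.keys Q. Poly_Mapping.lookup Q \<alpha> * L (mon \<alpha> * P j $ b))"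
    by (subst (1) polynomial_eq_sum_mon[of Q])
      (simp add: sum_distrib_right scaleR_times_left L_sum L_scaleR S
        real_vector.subspace_scale[OF subspace_Sym])
  ultimately show ?thesis by simp
qed

lemma P_orthogonal:
  assumes "a < r i" "b < r j" "i \<noteq> j"
  shows "L (P i $ a * P j $ b) = 0"
proof -
  have *: "L (P i $ a * P j $ b) = 0" if "a < r i" "b < r j" "i < j" for i j a b
    using that P_entry[OF that(1)] P_entry[OF that(2)]
    by (intro low_degree_orthogonal[of _ "nat i"]) auto
  show ?thesis
    using *[OF assms(1,2)] *[OF assms(2,1)] assms(3) by (cases "i < j") (auto simp: mult.commute)
qed

section \<open>Triangularity, independence and spanning\<close>

lemma comb_in_Sym: "(\<Sum>j\<in>J. \<Sum>b<r j. c j b *\<^sub>R P j $ b) \<in> Sym N"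
  by (intro real_vector.subspace_sum[OF subspace_Sym] real_vector.subspace_scale[OF subspace_Sym])
    (auto intro: P_entry)

lemma L_times_comb:
  assumes "Q \<in> Sym N"
  shows "L (Q * (\<Sum>j\<in>J. \<Sum>b<r j. c j b *\<^sub>R P j $ b)) =
    (\<Sum>j\<in>J. \<Sum>b<r j. c j b * L (Q * P j $ b))"
proof -
  have S: "Q * P j $ b \<in> Sym N" if "b < r j" for j b
    using times_in_Sym[OF assms P_entry(1)[OF that]] .
  have "Q * (\<Sum>j\<in>J. \<Sum>b<r j. c j b *\<^sub>R P j $ b) =
    (\<Sum>j\<in>J. \<Sum>b<r j. c j b *\<^sub>R (Q * P j $ b))"
    by (simp add: sum_distrib_left scaleR_times_right)
  moreover have "(\<Sum>b<r j. c j b *\<^sub>R (Q * P j $ b)) \<in> Sym N" for j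
    by (intro real_vector.subspace_sum[OF subspace_Sym] real_vector.subspace_scale[OF subspace_Sym])
      (auto intro: S)
  moreover have "L (\<Sum>b<r j. c j b *\<^sub>R (Q * P j $ b)) = (\<Sum>b<r j. c j b * L (Q * P j $ b))" for j
    by (subst L_sum) (auto simp: L_scaleR S intro!: real_vector.subspace_scale[OF subspace_Sym])
  ultimately show ?thesis by (simp add: L_sum)
qed

text \<open>Forward substitution in the block triangular system: pairing with the monomials of degree \<open>j\<close>
  kills the terms above \<open>j\<close> by orthogonality and those below \<open>j\<close> by induction, and the diagonal
  block that remains is invertible.\<close>

lemma low_coefficients_zero:
  assumes J: "finite J"
    and zero: "\<And>\<alpha>. \<alpha> \<in> monomials N \<Longrightarrow> int (tdeg \<alpha>) < lo \<Longrightarrow>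
      L (mon \<alpha> * (\<Sum>j\<in>J. \<Sum>b<r j. c j b *\<^sub>R P j $ b)) = 0"
  shows "j \<in> J \<Longrightarrow> j < lo \<Longrightarrow> b < r j \<Longrightarrow> c j b = 0"
proof (induction "nat j" arbitrary: j b rule: less_induct)
  case less
  from less.prems have j0: "0 \<le> j" by (simp add: P_entry(3))
  let ?A = "pairing L (ws (nat j)) (p (nat j))"
  let ?c = "vec (r j) (c j)"
  have A: "?A \<in> carrier_mat (r j) (r j)"
    using j0 dim_P[of j] by (simp add: pairing_def dim_ws ext_neg_def)
  have Ac: "?A *\<^sub>v ?c = 0\<^sub>v (r j)"
  proof (rule eq_vecI)
    fix a assume "a < dim_vec (0\<^sub>v (r j) :: real vec)"
    then have a: "a < r j" by simp
    then have "ws (nat j) $ a \<in> set\<^sub>v (ws (nat j))" using j0 by (auto simp: vec_set_def dim_ws)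
    then obtain \<alpha> where \<alpha>: "\<alpha> \<in> monomials N" "tdeg \<alpha> = nat j" "ws (nat j) $ a = mon \<alpha>"
      by (auto simp: set_ws)
    have "0 = (\<Sum>j'\<in>J. \<Sum>b<r j'. c j' b * L (mon \<alpha> * P j' $ b))"
      using zero[of \<alpha>] less.prems j0 \<alpha> by (simp add: L_times_comb mon_in_Sym)
    also have "\<dots> = (\<Sum>j'\<in>{j}. \<Sum>b<r j'. c j' b * L (mon \<alpha> * P j' $ b))"
    proof (rule sum.mono_neutral_right[OF J])
      show "\<forall>j'\<in>J - {j}. (\<Sum>b<r j'. c j' b * L (mon \<alpha> * P j' $ b)) = 0"
      proof (intro ballI sum.neutral)
        fix j' b' assume j': "j' \<in> J - {j}" and "b' \<in> {..<r j'}"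
        then have b': "b' < r j'" by simp
        show "c j' b' * L (mon \<alpha> * P j' $ b') = 0"
        proof (cases "j' < j")
          case True
          then have "c j' b' = 0"
            using less.prems j' b' P_entry(3)[OF b'] by (intro less.hyps) auto
          then show ?thesis by simp
        next
          case False
          then show ?thesis using j' b' \<alpha> j0 by (simp add: mon_orthogonal)
        qed
      qed
    qed (use less.prems in auto)
    finally show "(?A *\<^sub>v ?c) $ a = 0\<^sub>v (r j) $ a"
      using a A j0 \<alpha>(3) dim_P[of j]
      by (simp add: scalar_prod_def pairing_def dim_ws ext_neg_def atLeast0LessThan mult.commute)
  qed (use A in simp)
  obtain B where B: "inverts_mat B ?A" "inverts_mat ?A B"
    using bo unfolding block_orthogonal_def invertible_mat_def by blast
  \<comment> \<open>The size of \<open>B\<close> is forced, since an identity matrix is square.\<close>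
  have dB: "B \<in> carrier_mat (r j) (r j)"
  proof
    have "dim_col (B * ?A) = dim_row B" using B(1) by (simp add: inverts_mat_def)
    then show "dim_row B = r j" using A by simp
    have "dim_col (?A * B) = dim_row ?A" using B(2) by (simp add: inverts_mat_def)
    then show "dim_col B = r j" using A by simp
  qed
  have "?c = (B * ?A) *\<^sub>v ?c" using B(1) dB by (simp add: inverts_mat_def)
  also have "\<dots> = B *\<^sub>v (?A *\<^sub>v ?c)" using A dB by (intro assoc_mult_mat_vec) auto
  also have "\<dots> = 0\<^sub>v (r j)" unfolding Ac using dB by auto
  finally have "?c $ b = 0\<^sub>v (r j) $ b" by simp
  then show ?case using less.prems by simp
qed

corollary P_independent:
  assumes "finite J" "(\<Sum>j\<in>J. \<Sum>b<r j. c j b *\<^sub>R P j $ b) = 0" "j \<in> J" "b < r j"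
  shows "c j b = 0"
proof (rule low_coefficients_zero[of J "j + 1"])
  show "L (mon \<alpha> * (\<Sum>j\<in>J. \<Sum>b<r j. c j b *\<^sub>R P j $ b)) = 0" for \<alpha>
    using L_scaleR[of 0 0] assms(2) by (simp add: Sym_def)
qed (use assms in auto)

lemma in_span_mon:
  assumes "Q \<in> Sym N" "tdeg_le Q d"
  shows "Q \<in> span (mon ` {\<alpha> \<in> monomials N. tdeg \<alpha> \<le> d})"
proof -
  have "(\<Sum>\<alpha>\<in>Poly_Mapping.keys Q. Poly_Mapping.lookup Q \<alpha> *\<^sub>R mon \<alpha>)
      \<in> span (mon ` {\<alpha> \<in> monomials N. tdeg \<alpha> \<le> d})"
    using assms
    by (intro real_vector.span_sum real_vector.span_scale real_vector.span_base)
      (auto simp: Sym_def tdeg_le_def)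
  then show ?thesis using polynomial_eq_sum_mon[of Q] by simp
qed

text \<open>The monomials of degree at most \<open>d\<close> are as many as the entries of the vectors \<open>P j\<close> with
  \<open>0 \<le> j \<le> d\<close>, and the latter are independent.\<close>

lemma P_spans:
  assumes "Q \<in> Sym N" "tdeg_le Q d"
  shows "\<exists>c. Q = (\<Sum>j\<in>{0..int d}. \<Sum>b<r j. c j b *\<^sub>R P j $ b)"
proof -
  let ?I = "SIGMA j:{0..int d}. {..<r j}"
  let ?T = "mon ` {\<alpha> \<in> monomials N. tdeg \<alpha> \<le> d}"
  have Teq: "{\<alpha> \<in> monomials N. tdeg \<alpha> \<le> d} =
      (\<Union>j\<in>{0..int d}. {\<alpha> \<in> monomials N. int (tdeg \<alpha>) = j})" by auto
  have fin: "finite {\<alpha> \<in> monomials N. int (tdeg \<alpha>) = j}" for j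
    by (rule finite_subset[OF _ finite_monomials[of "nat j"]]) auto
  have "card ?T \<le> (\<Sum>j\<in>{0..int d}. r j)"
    unfolding card_image[OF inj_mon] Teq num_monomials_def by (rule card_UN_le) simp
  then have card: "card ?T \<le> card ?I" by simp
  have "\<exists>c. Q = (\<Sum>x\<in>?I. c x *\<^sub>R P (fst x) $ (snd x))"
  proof (rule span_family_eq_of_card_le[OF _ _ card])
    show "finite ?T" unfolding Teq using fin by simp
    show "(\<lambda>x. P (fst x) $ snd x) ` ?I \<subseteq> span ?T"
    proof safe
      fix j b assume jb: "j \<in> {0..int d}" "b < r j"
      then have "tdeg_le (P j $ b) d" using P_entry(2)[OF jb(2)] by (force simp: tdeg_le_def)
      then show "P (fst (j, b)) $ snd (j, b) \<in> span ?T" using P_entry(1)[OF jb(2)] in_span_mon by simp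
    qed
    show "\<forall>x\<in>?I. c x = 0" if "(\<Sum>x\<in>?I. c x *\<^sub>R P (fst x) $ (snd x)) = 0" for c
    proof -
      have "(\<Sum>j\<in>{0..int d}. \<Sum>b<r j. c (j, b) *\<^sub>R P j $ b) = 0"
        using that by (simp add: sum.Sigma case_prod_beta)
      then show ?thesis using P_independent[of "{0..int d}" "\<lambda>j b. c (j, b)"] by auto
    qed
  qed (use in_span_mon[OF assms] in auto)
  then obtain c where "Q = (\<Sum>x\<in>?I. c x *\<^sub>R P (fst x) $ (snd x))" ..
  then have "Q = (\<Sum>j\<in>{0..int d}. \<Sum>b<r j. c (j, b) *\<^sub>R P j $ b)"
    by (simp add: sum.Sigma case_prod_beta)
  then show ?thesis by (rule exI[of _ "\<lambda>j b. c (j, b)"])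
qed

section \<open>The recurrence and its symmetry\<close>

text \<open>The recurrence, written entry by entry.\<close>

lemma recurrence_matrices_iff:
  "recurrence_matrices N p n m i A \<longleftrightarrow>
     (\<forall>k\<in>{- int m..int m}. A k \<in> carrier_mat (r (int n - int m)) (r (int n - int m + k))) \<and>
     (\<forall>a<r (int n - int m). indet m i * P (int n - int m) $ a =
       (\<Sum>k\<in>{- int m..int m}. \<Sum>b<r (int n - int m + k). A k $$ (a, b) *\<^sub>R P (int n - int m + k) $ b))"
proof -
  let ?s = "int n - int m"
  let ?K = "{- int m..int m}"
  let ?S = "finsum_vec TYPE(polynomial) (r ?s)
    (\<lambda>k. map_mat (Poly_Mapping.single 0) (A k) *\<^sub>v P (?s + k)) ?K"
  have "indet m i \<cdot>\<^sub>v P ?s = ?S \<longleftrightarrow> (\<forall>a<r ?s. indet m i * P ?s $ a =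
      (\<Sum>k\<in>?K. \<Sum>b<r (?s + k). A k $$ (a, b) *\<^sub>R P (?s + k) $ b))"
    if A: "\<forall>k\<in>?K. A k \<in> carrier_mat (r ?s) (r (?s + k))"
  proof -
    have cv: "(\<lambda>k. map_mat (Poly_Mapping.single 0) (A k) *\<^sub>v P (?s + k)) \<in>
        ?K \<rightarrow> carrier_vec (r ?s)"
    proof
      fix k assume "k \<in> ?K"
      with A have "A k \<in> carrier_mat (r ?s) (r (?s + k))" by blast
      then show "map_mat (Poly_Mapping.single 0) (A k) *\<^sub>v P (?s + k) \<in> carrier_vec (r ?s)"
        by (intro carrier_vecI) simp
    qed
    have "?S $ a = (\<Sum>k\<in>?K. \<Sum>b<r (?s + k). A k $$ (a, b) *\<^sub>R P (?s + k) $ b)"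
      if a: "a < r ?s" for a
    proof -
      have "(map_mat (Poly_Mapping.single 0) (A k) *\<^sub>v P (?s + k)) $ a =
          (\<Sum>b<r (?s + k). A k $$ (a, b) *\<^sub>R P (?s + k) $ b)" if "k \<in> ?K" for k
      proof -
        have "A k \<in> carrier_mat (r ?s) (r (?s + k))" using A that by blast
        then show ?thesis
          using a by (simp add: scalar_prod_def atLeast0LessThan single_0_times)
      qed
      then show ?thesis by (subst index_finsum_vec[OF _ a cv]) auto
    qed
    moreover have "dim_vec ?S = r ?s" using finsum_vec_closed[OF cv] by simp
    ultimately show ?thesis by (simp add: vec_eq_iff)
  qed
  then show ?thesis unfolding recurrence_matrices_def by (intro conj_cong refl)
qed

lemma recurrence_matrices_exist:
  assumes m: "m \<in> {1..n}" and i: "i \<in> {1..N m}"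
  shows "\<exists>A. recurrence_matrices N p n m i A"
proof -
  let ?s = "int n - int m"
  let ?K = "{- int m..int m}"
  have ind: "Poly_Mapping.single (m, i) 1 \<in> monomials N" using m i indet_monomial by simp
  have "\<exists>f. indet m i * P ?s $ a = (\<Sum>k\<in>?K. \<Sum>b<r (?s + k). f k b *\<^sub>R P (?s + k) $ b)"
    if a: "a < r ?s" for a
  proof -
    let ?Q = "indet m i * P ?s $ a"
    have "?Q \<in> Sym N"
      using times_in_Sym[OF mon_in_Sym[OF ind] P_entry(1)[OF a]] by (simp add: indet_eq_mon)
    moreover have "tdeg_le ?Q n"
    proof -
      have "tdeg_le (indet m i) m" by (simp add: tdeg_le_def indet_eq_mon tdeg_single[simplified])
      moreover have "m + nat ?s = n" using m by auto
      ultimately show ?thesis using tdeg_le_times[OF _ P_entry(2)[OF a]] by metis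
    qed
    ultimately obtain c where c: "?Q = (\<Sum>j\<in>{0..int n}. \<Sum>b<r j. c j b *\<^sub>R P j $ b)"
      using P_spans[of ?Q n] by auto
    \<comment> \<open>Multiplication by \<open>w\<^sub>m\<^sub>,\<^sub>i\<close> moves monomials of degree below \<open>n - 2m\<close> to degree below
      \<open>n - m\<close>, where they are orthogonal to \<open>p\<^sub>n\<^sub>-\<^sub>m\<close>.\<close>
    have low: "c j b = 0" if "j \<in> {0..int n}" "j < ?s - int m" "b < r j" for j b
    proof (rule low_coefficients_zero[of "{0..int n}" "?s - int m"])
      fix \<alpha> assume \<alpha>: "\<alpha> \<in> monomials N" "int (tdeg \<alpha>) < ?s - int m"
      let ?\<beta> = "\<alpha> + Poly_Mapping.single (m, i) 1"
      have "mon \<alpha> * ?Q = mon ?\<beta> * P ?s $ a"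
        by (simp add: indet_eq_mon mult_single flip: mult.assoc)
      moreover have "L (mon ?\<beta> * P ?s $ a) = 0"
        using \<alpha> ind a
        by (intro mon_orthogonal monomials_add) (simp_all add: tdeg_add tdeg_single[simplified])
      ultimately show "L (mon \<alpha> * (\<Sum>j\<in>{0..int n}. \<Sum>b<r j. c j b *\<^sub>R P j $ b)) = 0"
        using c by simp
    qed (use that in auto)
    let ?t = "\<lambda>j. \<Sum>b<r j. c j b *\<^sub>R P j $ b"
    let ?I = "{max 0 (?s - int m)..int n}"
    have "(\<Sum>j\<in>{0..int n}. ?t j) = (\<Sum>j\<in>?I. ?t j)"
      by (intro sum.mono_neutral_right) (auto intro!: sum.neutral low)
    \<comment> \<open>If \<open>n < 2m\<close>, the negative indices contribute empty sums.\<close>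
    also have "\<dots> = (\<Sum>j\<in>{?s - int m..int n}. ?t j)"
      by (intro sum.mono_neutral_left) (auto simp: r_negative)
    also have "\<dots> = (\<Sum>k\<in>?K. ?t (?s + k))"
      by (rule sum.reindex_bij_witness[of _ "\<lambda>k. ?s + k" "\<lambda>j. j - ?s"]) auto
    finally show ?thesis using c by (intro exI[of _ "\<lambda>k. c (?s + k)"]) simp
  qed
  then have "\<forall>a. \<exists>f. a < r ?s \<longrightarrow>
      indet m i * P ?s $ a = (\<Sum>k\<in>?K. \<Sum>b<r (?s + k). f k b *\<^sub>R P (?s + k) $ b)"
    by blast
  from choice[OF this] obtain f where f: "\<And>a. a < r ?s \<Longrightarrow>
      indet m i * P ?s $ a = (\<Sum>k\<in>?K. \<Sum>b<r (?s + k). f a k b *\<^sub>R P (?s + k) $ b)"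
    by blast
  show ?thesis
    unfolding recurrence_matrices_iff
    by (rule exI[of _ "\<lambda>k. mat (r ?s) (r (?s + k)) (\<lambda>(a, b). f a k b)"]) (simp add: f)
qed

lemma recurrence_matrices_unique:
  assumes A: "recurrence_matrices N p n m i A" and B: "recurrence_matrices N p n m i B"
    and k: "k \<in> {- int m..int m}"
  shows "A k = B k"
proof -
  let ?s = "int n - int m"
  let ?K = "{- int m..int m}"
  note A = A[unfolded recurrence_matrices_iff] and B = B[unfolded recurrence_matrices_iff]
  have dims: "A k \<in> carrier_mat (r ?s) (r (?s + k))" "B k \<in> carrier_mat (r ?s) (r (?s + k))"
    using A B k by blast+
  show ?thesis
  proof (rule eq_matI)
    fix a b assume "a < dim_row (B k)" "b < dim_col (B k)"
    then have a: "a < r ?s" and b: "b < r (?s + k)" using dims by auto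
    let ?d = "\<lambda>j b. A (j - ?s) $$ (a, b) - B (j - ?s) $$ (a, b)"
    have "(\<Sum>j\<in>(+) ?s ` ?K. \<Sum>b<r j. ?d j b *\<^sub>R P j $ b) =
        (\<Sum>k\<in>?K. \<Sum>b<r (?s + k). A k $$ (a, b) *\<^sub>R P (?s + k) $ b) -
        (\<Sum>k\<in>?K. \<Sum>b<r (?s + k). B k $$ (a, b) *\<^sub>R P (?s + k) $ b)"
      by (subst sum.reindex) (simp_all add: scaleR_diff_left sum_subtractf)
    also have "\<dots> = indet m i * P ?s $ a - indet m i * P ?s $ a"
      using A[THEN conjunct2, rule_format, OF a] B[THEN conjunct2, rule_format, OF a] by simp
    also have "\<dots> = 0" by simp
    finally have "?d (?s + k) b = 0"
      using k b by (intro P_independent[of "(+) ?s ` ?K" ?d]) simp_all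
    then show "A k $$ (a, b) = B k $$ (a, b)" by simp
  qed (use dims in auto)
qed

text \<open>Pairing the recurrence with one of the vectors \<open>P (s + k)\<close> isolates the \<open>k\<close>-th summand, because
  distinct blocks are orthogonal.\<close>

lemma recurrence_matrix_times_gram:
  assumes A: "recurrence_matrices N p n m i A" and k: "k \<in> {- int m..int m}"
  defines "s \<equiv> int n - int m"
  shows "A k * gram L p (s + k) =
    mat (r s) (r (s + k)) (\<lambda>(a, b). L (indet m i * P s $ a * P (s + k) $ b))"
proof -
  let ?K = "{- int m..int m}"
  have d: "A k \<in> carrier_mat (r s) (r (s + k))"
    using A k unfolding recurrence_matrices_iff s_def by blast
  show ?thesis
  proof (rule eq_matI; clarsimp simp: d[THEN carrier_matD(1)])
    fix a b assume a: "a < r s" and b: "b < r (s + k)"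
    have "L (P (s + k) $ b * (\<Sum>j\<in>(+) s ` ?K. \<Sum>b<r j. A (j - s) $$ (a, b) *\<^sub>R P j $ b)) =
        (\<Sum>j\<in>(+) s ` ?K. \<Sum>c<r j. A (j - s) $$ (a, c) * L (P (s + k) $ b * P j $ c))"
      by (rule L_times_comb[OF P_entry(1)[OF b]])
    also have "\<dots> = (\<Sum>j\<in>{s + k}. \<Sum>c<r j. A (j - s) $$ (a, c) * L (P (s + k) $ b * P j $ c))"
      using k b by (intro sum.mono_neutral_right) (auto intro!: sum.neutral simp: P_orthogonal)
    also have "\<dots> = (A k * gram L p (s + k)) $$ (a, b)"
      using a b d by (simp add: scalar_prod_def gram_def pairing_def atLeast0LessThan mult.commute)
    also have "(\<Sum>j\<in>(+) s ` ?K. \<Sum>b<r j. A (j - s) $$ (a, b) *\<^sub>R P j $ b) = indet m i * P s $ a"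
      using A a unfolding recurrence_matrices_iff s_def by (subst sum.reindex) simp_all
    finally show "(A k * gram L p (s + k)) $$ (a, b) = L (indet m i * P s $ a * P (s + k) $ b)"
      by (simp add: mult.commute)
  qed (simp add: gram_def pairing_def)
qed

lemma gram_carrier: "gram L p j \<in> carrier_mat (r j) (r j)"
  by (simp add: gram_def pairing_def)

lemma gram_symmetric: "transpose_mat (gram L p j) = gram L p j"
  by (rule eq_matI) (simp_all add: gram_def pairing_def mult.commute)

lemma recurrence_matrices_symmetry:
  assumes k: "k \<in> {- int m..int m}"
    and A: "recurrence_matrices N p n m i A" and B: "recurrence_matrices N p n' m i B"
    and n': "int n' = int n + k"
  shows "A k * gram L p (int n - int m + k) =
    gram L p (int n - int m) * transpose_mat (B (- k))"
proof -
  let ?s = "int n - int m"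
  have s: "int n' - int m = ?s + k" "?s + k + - k = ?s" using n' by simp_all
  have k': "- k \<in> {- int m..int m}" using k by simp
  have B': "B (- k) \<in> carrier_mat (r (?s + k)) (r ?s)"
    using B k' s unfolding recurrence_matrices_iff by metis
  have "gram L p ?s * transpose_mat (B (- k)) = transpose_mat (B (- k) * gram L p ?s)"
    using transpose_mult[OF B' gram_carrier] by (simp add: gram_symmetric)
  also have "B (- k) * gram L p ?s =
      mat (r (?s + k)) (r ?s) (\<lambda>(b, a). L (indet m i * P (?s + k) $ b * P ?s $ a))"
    using recurrence_matrix_times_gram[OF B k'] unfolding s by simp
  also have "transpose_mat \<dots> =
      mat (r ?s) (r (?s + k)) (\<lambda>(a, b). L (indet m i * P ?s $ a * P (?s + k) $ b))"
    by (rule eq_matI) (simp_all add: mult_ac)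
  also have "\<dots> = A k * gram L p (?s + k)"
    by (rule recurrence_matrix_times_gram[OF A k, symmetric])
  finally show ?thesis ..
qed

end

theorem proposition3p2:
  fixes N :: "nat \<Rightarrow> nat" and L :: "polynomial \<Rightarrow> real"
    and ws p :: "nat \<Rightarrow> polynomial vec"
  assumes "monomial_vectors N ws"
    and "linear_functional N L"
    and "quasi_definite N L"
    and "block_orthogonal N L ws p"
  shows "\<exists>M :: nat \<Rightarrow> nat \<Rightarrow> nat \<Rightarrow> int \<Rightarrow> real mat.
    (\<forall>n. \<forall>m\<in>{1..n}. \<forall>i\<in>{1..N m}.
        recurrence_matrices N p n m i (M n m i) \<and>
        (\<forall>A. recurrence_matrices N p n m i A \<longrightarrow> (\<forall>k\<in>{- int m..int m}. A k = M n m i k))) \<and>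
    (\<forall>n m i k. n < m \<longrightarrow> M n m i k = 0\<^sub>m 0 (num_monomials N (int n - int m + k))) \<and>
    (\<forall>n. \<forall>m\<in>{1..n}. \<forall>i\<in>{1..N m}. \<forall>k\<in>{- int m..int m}.
        M n m i k * gram L p (int n - int m + k) =
        gram L p (int n - int m) * transpose_mat (M (nat (int n + k)) m i (- k)))"
proof -
  interpret block_orthogonal_system N L ws p
    using assms by unfold_locales
  define M where "M n m i k =
      (if n < m then 0\<^sub>m 0 (num_monomials N (int n - int m + k))
       else (SOME A. recurrence_matrices N p n m i A) k)" for n m i k
  have M: "recurrence_matrices N p n m i (M n m i)" if "m \<in> {1..n}" "i \<in> {1..N m}" for n m i
  proof -
    have "M n m i = (SOME A. recurrence_matrices N p n m i A)"
      using that by (simp add: M_def fun_eq_iff)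
    then show ?thesis using someI_ex[OF recurrence_matrices_exist[OF that]] by simp
  qed
  show ?thesis
  proof (rule exI[of _ M], intro conjI allI ballI impI)
    fix n m i assume mi: "m \<in> {1..n}" "i \<in> {1..N m}"
    show "recurrence_matrices N p n m i (M n m i)" using M[OF mi] .
    show "A k = M n m i k"
      if "recurrence_matrices N p n m i A" "k \<in> {- int m..int m}" for A k
      using recurrence_matrices_unique[OF that(1) M[OF mi] that(2)] .
    fix k assume k: "k \<in> {- int m..int m}"
    let ?s = "int n - int m"
    show "M n m i k * gram L p (?s + k) =
        gram L p ?s * transpose_mat (M (nat (int n + k)) m i (- k))"
    proof (cases "int n + k < int m")
      \<comment> \<open>Here \<open>n - m + k < 0\<close>: both products have an empty inner dimension and vanish.\<close>
      case True
      have lt: "nat (int n + k) < m" "int (nat (int n + k)) = int n + k" using True k mi by auto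
      have "M n m i k \<in> carrier_mat (r ?s) (r (?s + k))"
        using M[OF mi] k unfolding recurrence_matrices_iff by blast
      moreover have "r (?s + k) = 0" using True by (intro r_negative) simp
      moreover have "M (nat (int n + k)) m i (- k) = 0\<^sub>m 0 (r ?s)"
        using lt by (simp add: M_def)
      ultimately show ?thesis
        using gram_carrier[of ?s] gram_carrier[of "?s + k"]
        by (intro eq_matI) (auto simp: scalar_prod_def)
    next
      case False
      then have "m \<in> {1..nat (int n + k)}" using mi by auto
      from recurrence_matrices_symmetry[OF k M[OF mi] M[OF this mi(2)]] show ?thesis
        using mi k by simp
    qed
  qed (simp add: M_def)
qed

end
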